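(* Let $\mathcal{L}\in\{\mathrm{PL},\mathrm{PL}(\underline{\vee}),\mathrm{PD}\}$ and let $\varphi$ be an $\mathcal{L}$-formula. Every tableau for $\varphi$ in $\mathbf{T}_{\mathcal{L}}$ is finite.
   Context: Syntax (negation normal form) over proposition symbols: $\mathrm{PL}$: $\varphi::=p\mid\neg p\mid(\varphi\wedge\varphi)\mid(\varphi\vee\varphi)$; $\mathrm{PL}(\underline{\vee})$ adds intuitionistic disjunction $(\varphi\,\underline{\vee}\,\varphi)$; $\mathrm{PD}$ adds dependence atoms ${=}(p_1,\dots,p_n,q)$, $n\ge0$. For a proposition symbol $p$, $p^\top:=p$, $p^\bot:=\neg p$. $\mathrm{vrank}(\varphi)$ is the number of occurrences of $\underline{\vee}$ in $\varphi$, where for $\mathrm{PD}$ formulas each atom ${=}(p_1,\dots,p_n,q)$ is first replaced by $\bigvee_{\vec a\in\{\bot,\top\}^n}\bigwedge\{p_1^{a_1},\dots,p_n^{a_n},(q\,\underline{\vee}\,\neg q)\}$ (so contributes $2^n$); for $\mathrm{PL}$ formulas $\mathrm{vrank}=0$. Labeled tableaux: a label is a finite subset of $\mathbb{N}$; a labeled formula is $\alpha:\varphi$ (intended: the team named $\alpha$ falsifies $\varphi$). A tableau is a finitely branching tree whose nodes are labeled formulas, built from the root by rule applications: a rule whose premise lies on a branch extends that branch by the listed alternatives (separated by $\mid$), each alternative adding all its listed labeled formulas. A labeled formula is never added to a branch in which it already occurs. Rules: (Prop) from $\{i_1,\dots,i_k\}:p$: $\{i_1\}:p\mid\dots\mid\{i_k\}:p$.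 ($\neg$Prop) likewise for $\neg p$. ($\wedge$) from $\alpha:(\varphi\wedge\psi)$: $\alpha:\varphi\mid\alpha:\psi$. ($\vee$) from $\alpha:(\varphi\vee\psi)$, for any $\beta\subseteq\alpha$: $\beta:\varphi\mid\alpha\setminus\beta:\psi$. ($\underline{\vee}$) from $\alpha:(\varphi\,\underline{\vee}\,\psi)$: add both $\alpha:\varphi$ and $\alpha:\psi$ (one branch). (Split) from $\alpha:{=}(p_1,\dots,p_n,q)$: $\alpha_1:{=}(\vec p,q)\mid\dots\mid\alpha_k:{=}(\vec p,q)$ where $\alpha_1,\dots,\alpha_k$ are exactly all subsets of $\alpha$ of cardinality 2. (PL dep) from $\{i_1,i_2\}:{=}(p_1,\dots,p_n,q)$: one alternative for each function $g:\{1,\dots,n\}\to\{\top,\bot\}$, adding $\{i_1\}:p_m^{g(m)}$ and $\{i_2\}:p_m^{g(m)}$ for $m=1,\dots,n$, together with $\{i_1,i_2\}:q$ and $\{i_1,i_2\}:\neg q$. Calculi: $\mathbf{T}_{\mathrm{PL}}$ = (Prop), ($\neg$Prop), ($\wedge$), ($\vee$); $\mathbf{T}_{\mathrm{PL}(\underline{\vee})}$ = $\mathbf{T}_{\mathrm{PL}}$ + ($\underline{\vee}$); $\mathbf{T}_{\mathrm{PD}}$ = $\mathbf{T}_{\mathrm{PL}}$ + (Split) + (PL dep). A tableau for $\varphi$ in $\mathbf{T}_{\mathcal{L}}$ is one with root $\{1,\dots,2^{\mathrm{vrank}(\varphi)}\}:\varphi$ obtained by applying rules of $\mathbf{T}_{\mathcal{L}}$.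 *)

theory Defs
  imports Main
begin

text \<open>
  One datatype covers the three languages; \<open>Dep ps q\<close> is the dependence atom
  with determining symbols \<open>ps\<close> (possibly none, possibly repeated) and dependent symbol \<open>q\<close>.
  Proposition symbols are the elements of an arbitrary type.
\<close>

datatype 'p form =
    Prop 'p
  | NProp 'p
  | And "'p form" "'p form"
  | Or "'p form" "'p form"
  | IOr "'p form" "'p form"
  | Dep "'p list" 'p

datatype logic = PL | PL_IOr | PD

primrec is_formula :: "logic \<Rightarrow> 'p form \<Rightarrow> bool" where
  "is_formula L (Prop p) = True"
| "is_formula L (NProp p) = True"
| "is_formula L (And \<phi> \<psi>) = (is_formula L \<phi> \<and> is_formula L \<psi>)"
| "is_formula L (Or \<phi> \<psi>) = (is_formula L \<phi> \<and> is_formula L \<psi>)"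
| "is_formula L (IOr \<phi> \<psi>) = (L = PL_IOr \<and> is_formula L \<phi> \<and> is_formula L \<psi>)"
| "is_formula L (Dep ps q) = (L = PD)"

definition lit :: "'p \<Rightarrow> bool \<Rightarrow> 'p form" where
  "lit p b = (if b then Prop p else NProp p)"

(* Only ever applied to nonempty lists; the bracketing is immaterial for vrank. *)
fun big_and :: "'p form list \<Rightarrow> 'p form" where
  "big_and [\<phi>] = \<phi>"
| "big_and (\<phi> # \<psi> # \<chi>s) = And \<phi> (big_and (\<psi> # \<chi>s))"

fun big_or :: "'p form list \<Rightarrow> 'p form" where
  "big_or [\<phi>] = \<phi>"
| "big_or (\<phi> # \<psi> # \<chi>s) = Or \<phi> (big_or (\<psi> # \<chi>s))"

primrec expand_dep :: "'p form \<Rightarrow> 'p form" where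
  "expand_dep (Prop p) = Prop p"
| "expand_dep (NProp p) = NProp p"
| "expand_dep (And \<phi> \<psi>) = And (expand_dep \<phi>) (expand_dep \<psi>)"
| "expand_dep (Or \<phi> \<psi>) = Or (expand_dep \<phi>) (expand_dep \<psi>)"
| "expand_dep (IOr \<phi> \<psi>) = IOr (expand_dep \<phi>) (expand_dep \<psi>)"
| "expand_dep (Dep ps q) =
     big_or (map (\<lambda>a. big_and (map2 lit ps a @ [IOr (Prop q) (NProp q)]))
       (List.n_lists (length ps) [False, True]))"

primrec count_IOr :: "'p form \<Rightarrow> nat" where
  "count_IOr (Prop p) = 0"
| "count_IOr (NProp p) = 0"
| "count_IOr (And \<phi> \<psi>) = count_IOr \<phi> + count_IOr \<psi>"
| "count_IOr (Or \<phi> \<psi>) = count_IOr \<phi> + count_IOr \<psi>"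
| "count_IOr (IOr \<phi> \<psi>) = Suc (count_IOr \<phi> + count_IOr \<psi>)"
| "count_IOr (Dep ps q) = 0"

definition vrank :: "'p form \<Rightarrow> nat" where
  "vrank \<phi> = count_IOr (expand_dep \<phi>)"

(* Labels are finite because the root label is finite and the rules only pass to subsets. *)
type_synonym 'p lform = "nat set \<times> 'p form"

text \<open>
  \<open>rule L x As\<close>: in the calculus for \<open>L\<close>, the premise \<open>x\<close> yields the alternatives \<open>As\<close>,
  each alternative being the set of labeled formulas it lists.  Where the alternatives are
  indexed by a finite set, they may be listed in any order.
\<close>

inductive rule :: "logic \<Rightarrow> 'p lform \<Rightarrow> 'p lform set list \<Rightarrow> bool" for L where
  atom: "distinct js \<Longrightarrow> set js = \<alpha> \<Longrightarrow>
    rule L (\<alpha>, Prop p) (map (\<lambda>i. {({i}, Prop p)}) js)"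
| natom: "distinct js \<Longrightarrow> set js = \<alpha> \<Longrightarrow>
    rule L (\<alpha>, NProp p) (map (\<lambda>i. {({i}, NProp p)}) js)"
| conj: "rule L (\<alpha>, And \<phi> \<psi>) [{(\<alpha>, \<phi>)}, {(\<alpha>, \<psi>)}]"
| disj: "\<beta> \<subseteq> \<alpha> \<Longrightarrow> rule L (\<alpha>, Or \<phi> \<psi>) [{(\<beta>, \<phi>)}, {(\<alpha> - \<beta>, \<psi>)}]"
| idisj: "L = PL_IOr \<Longrightarrow> rule L (\<alpha>, IOr \<phi> \<psi>) [{(\<alpha>, \<phi>), (\<alpha>, \<psi>)}]"
| split: "L = PD \<Longrightarrow> distinct \<alpha>s \<Longrightarrow> set \<alpha>s = {\<beta>. \<beta> \<subseteq> \<alpha> \<and> card \<beta> = 2} \<Longrightarrow>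
    rule L (\<alpha>, Dep ps q) (map (\<lambda>\<beta>. {(\<beta>, Dep ps q)}) \<alpha>s)"
| pl_dep: "L = PD \<Longrightarrow> i\<^sub>1 \<noteq> i\<^sub>2 \<Longrightarrow> distinct gs \<Longrightarrow> set gs = {g :: bool list. length g = length ps} \<Longrightarrow>
    rule L ({i\<^sub>1, i\<^sub>2}, Dep ps q)
      (map (\<lambda>g. {({i}, lit (ps ! m) (g ! m)) | i m. i \<in> {i\<^sub>1, i\<^sub>2} \<and> m < length ps} \<union>
          {({i\<^sub>1, i\<^sub>2}, Prop q), ({i\<^sub>1, i\<^sub>2}, NProp q)}) gs)"

text \<open>
  Finitely branching trees, possibly of infinite depth.  A node is addressed by the sequence
  of child indices leading to it from the root.
\<close>

codatatype 'p tree = Node (root: "'p lform") (children: "'p tree list")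

primrec is_node :: "nat list \<Rightarrow> 'p tree \<Rightarrow> bool" where
  "is_node [] t = True"
| "is_node (i # v) t = (i < length (children t) \<and> is_node v (children t ! i))"

definition nodes :: "'p tree \<Rightarrow> nat list set" where
  "nodes t = {v. is_node v t}"

primrec chain :: "'p lform list \<Rightarrow> 'p tree list \<Rightarrow> 'p tree list" where
  "chain [] ts = ts"
| "chain (x # xs) ts = [Node x (chain xs ts)]"

text \<open>
  \<open>extends L B ts\<close>: the subtrees \<open>ts\<close> result from extending a branch, whose set of labeled
  formulas is \<open>B\<close>, by finitely or infinitely many rule applications.  An alternative \<open>A\<close> adds
  below the end of the branch a chain of those of its labeled formulas, in some order, that do
  not occur on the branch yet.  A rule application is excluded if one of its alternatives
  consists only of labeled formulas already on the branch: dropping just that alternative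
  would be unsound, and adding it would repeat a labeled formula.  The definition is
  coinductive so that infinite tableaux are not excluded beforehand.
\<close>

coinductive extends :: "logic \<Rightarrow> 'p lform set \<Rightarrow> 'p tree list \<Rightarrow> bool" for L where
  stop: "extends L B []"
| step: "x \<in> B \<Longrightarrow> rule L x As \<Longrightarrow>
    list_all2 (\<lambda>A t. \<exists>xs ts'. xs \<noteq> [] \<and> distinct xs \<and> set xs = A - B \<and>
      [t] = chain xs ts' \<and> extends L (B \<union> A) ts') As ts \<Longrightarrow>
    extends L B ts"

definition is_tableau :: "logic \<Rightarrow> 'p form \<Rightarrow> 'p tree \<Rightarrow> bool" where
  "is_tableau L \<phi> t \<longleftrightarrow>
     root t = ({1..2 ^ vrank \<phi>}, \<phi>) \<and> extends L {root t} (children t)"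

end

theory Submission
  imports Defs
begin

text \<open>
  Every rule adds only labeled formulas whose label is a subset of the premise's label and whose
  formula is a subformula of the premise's formula, where a dependence atom counts the literals
  over its symbols among its subformulas.  So all labeled formulas of a tableau lie in one
  finite set.  Each rule application adds to the branch something new from this set, which bounds
  the length of the branches, and the tree is finitely branching.
\<close>

primrec subforms :: "'p form \<Rightarrow> 'p form set" where
  "subforms (Prop p) = {Prop p}"
| "subforms (NProp p) = {NProp p}"
| "subforms (And \<phi> \<psi>) = insert (And \<phi> \<psi>) (subforms \<phi> \<union> subforms \<psi>)"
| "subforms (Or \<phi> \<psi>) = insert (Or \<phi> \<psi>) (subforms \<phi> \<union> subforms \<psi>)"
| "subforms (IOr \<phi> \<psi>) = insert (IOr \<phi> \<psi>) (subforms \<phi> \<union> subforms \<psi>)"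
| "subforms (Dep ps q) = insert (Dep ps q) (Prop ` set (q # ps) \<union> NProp ` set (q # ps))"

lemma finite_subforms: "finite (subforms \<phi>)"
  by (induction \<phi>) auto

lemma self_in_subforms: "\<phi> \<in> subforms \<phi>"
  by (cases \<phi>) auto

lemma subforms_mono: "\<psi> \<in> subforms \<phi> \<Longrightarrow> subforms \<psi> \<subseteq> subforms \<phi>"
  by (induction \<phi>) auto

lemma rule_subset_subforms:
  assumes "rule L x As" and "A \<in> set As"
  shows "A \<subseteq> Pow (fst x) \<times> subforms (snd x)"
  using assms
proof cases
  \<comment> \<open>Since \<open>m < length ps\<close>, each \<open>lit (ps ! m) (g ! m)\<close> is
    a literal over an entry of \<open>ps\<close>; the two formulas over \<open>q\<close> are covered
    because \<open>subforms\<close> uses \<open>q # ps\<close>.\<close>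
  case (pl_dep i\<^sub>1 i\<^sub>2 gs ps q)
  then show ?thesis using assms(2) by (fastforce simp: lit_def)
qed (auto simp: self_in_subforms)

lemma rule_subset:
  assumes "rule L x As" and "A \<in> set As" and "x \<in> Pow \<alpha> \<times> subforms \<phi>"
  shows "A \<subseteq> Pow \<alpha> \<times> subforms \<phi>"
proof -
  have "Pow (fst x) \<times> subforms (snd x) \<subseteq> Pow \<alpha> \<times> subforms \<phi>"
    using assms(3) subforms_mono[of "snd x" \<phi>] by (intro Sigma_mono Pow_mono) auto
  then show ?thesis
    using rule_subset_subforms[OF assms(1,2)] by blast
qed

text \<open>A nonempty address starts with one of finitely many child indices. This is where finite
  branching enters.\<close>

lemma finite_nodes_if_children:
  assumes "\<And>t'. t' \<in> set (children t) \<Longrightarrow> finite (nodes t')"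
  shows "finite (nodes t)"
proof -
  have "nodes t \<subseteq> insert [] (\<Union>i<length (children t). Cons i ` nodes (children t ! i))"
  proof
    fix v
    assume "v \<in> nodes t"
    then show "v \<in> insert [] (\<Union>i<length (children t). Cons i ` nodes (children t ! i))"
      by (cases v) (auto simp: nodes_def)
  qed
  moreover have "finite (insert [] (\<Union>i<length (children t). Cons i ` nodes (children t ! i)))"
    using assms by auto
  ultimately show ?thesis
    by (rule finite_subset)
qed

lemma finite_nodes_chain:
  assumes "\<And>t. t \<in> set ts \<Longrightarrow> finite (nodes t)" and "t \<in> set (chain xs ts)"
  shows "finite (nodes t)"
  using assms(2)
proof (induction xs arbitrary: t)
  case Nil
  then show ?case using assms(1) by simp
next
  case (Cons x xs)
  then show ?case using finite_nodes_if_children[of t] by simp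
qed

text \<open>Coinductive \<open>extends\<close> yields only case analysis, so the induction runs on
  the number of elements of \<open>U\<close> not yet on the branch. This measure takes the place of
  Koenig's lemma.\<close>

lemma extends_finite_nodes:
  assumes "finite U"
    and closed: "\<And>x As A. x \<in> U \<Longrightarrow> rule L x As \<Longrightarrow> A \<in> set As \<Longrightarrow> A \<subseteq> U"
    and "extends L B ts" and "B \<subseteq> U" and "t \<in> set ts"
  shows "finite (nodes t)"
  using assms(3-)
proof (induction "card (U - B)" arbitrary: B ts t rule: less_induct)
  case less
  from less.prems(1) show ?case
  proof cases
    case stop
    then show ?thesis using less.prems(3) by simp
  next
    case (step x As)
    obtain i where i: "i < length ts" "t = ts ! i"
      using less.prems(3) by (auto simp: in_set_conv_nth)
    \<comment> \<open>The alternative that \<open>list_all2\<close> pairs with the subtree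
      \<open>t\<close>.\<close>
    define A where "A = As ! i"
    have A: "A \<in> set As"
      using list_all2_lengthD[OF step(3)] i by (simp add: A_def)
    obtain xs ts' where xs: "xs \<noteq> []" "set xs = A - B"
      and t: "[t] = chain xs ts'" and ts': "extends L (B \<union> A) ts'"
      using list_all2_nthD2[OF step(3) i(1)] unfolding A_def i(2) by blast
    have "A \<subseteq> U"
      using closed step(1,2) A less.prems(2) by blast
    \<comment> \<open>The ban on repetitions enters here: the added chain is nonempty and consists
      of new labeled formulas, so the measure drops strictly.\<close>
    moreover have "A - B \<noteq> {}"
      using xs by (metis set_empty)
    ultimately have "U - (B \<union> A) \<subset> U - B"
      by blast
    then have "card (U - (B \<union> A)) < card (U - B)"
      using \<open>finite U\<close> by (simp add: psubset_card_mono)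
    then have "finite (nodes t')" if "t' \<in> set ts'" for t'
      using less.hyps ts' that \<open>A \<subseteq> U\<close> less.prems(2) by blast
    moreover have "t \<in> set (chain xs ts')"
      unfolding t[symmetric] by simp
    ultimately show ?thesis
      by (rule finite_nodes_chain)
  qed
qed

theorem theorem4:
  fixes L :: logic and \<phi> :: "'p form" and t :: "'p tree"
  assumes "is_formula L \<phi>"
    and "is_tableau L \<phi> t"
  shows "finite (nodes t)"
\<comment> \<open>\<open>extends\<close> describes the trees below a branch, so the root, which
  forms the initial branch, is split off first.\<close>
proof (rule finite_nodes_if_children)
  fix t'
  assume t': "t' \<in> set (children t)"
  let ?U = "Pow {1..(2::nat) ^ vrank \<phi>} \<times> subforms \<phi>"
  have fin: "finite ?U"
    by (simp add: finite_subforms)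
  have ext: "extends L {root t} (children t)" and root: "{root t} \<subseteq> ?U"
    using assms(2) by (auto simp: is_tableau_def self_in_subforms)
  show "finite (nodes t')"
  proof (rule extends_finite_nodes[OF fin _ ext root t'])
    show "A \<subseteq> ?U" if "x \<in> ?U" "rule L x As" "A \<in> set As" for x As A
      using that(2,3,1) by (rule rule_subset)
  qed
qed

end
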